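(* Let $G$ be a connected triangle-free and quadrangle-free graph with $n$ vertices, $m$ edges and diameter $d$, let $M_1$ be its first Zagreb index, and let $0<\alpha<1$. Put \[ L=\alpha^{d}\bigl(n(n-1)-M_1\bigr)+\alpha^{2}(M_1-2m)+2m\alpha,\qquad U=\alpha^{3}\bigl(n(n-1)-M_1\bigr)+\alpha^{2}(M_1-2m)+2m\alpha . \] Then $L\le GC(G)\le U$, and \[ \frac{n(n-1)-M_1}{2^{d}}+\frac{M_1+2m}{4}\;\le\; C(G)\;\le\;\frac{n(n-1)+M_1+4m}{8}. \] In each formula, equality holds (in both inequalities) if the diameter $d$ is at most $3$.
   Context: All graphs are finite and simple. A graph is triangle-free and quadrangle-free if it contains no cycle of length $3$ and no cycle of length $4$. For vertices $i,j$ of a connected graph $G$, $d(i,j)$ is their distance; the diameter is $\max_{i,j}d(i,j)$. The first Zagreb index is $M_1(G)=\sum_{v\in V(G)} d_v^2$, where $d_v$ is the degree of $v$. The closeness is $C(G)=\sum_{i\in V(G)}\sum_{j\neq i}2^{-d(i,j)}$, and for fixed $0<\alpha<1$ the generalized closeness is $GC(G)=\sum_{i\in V(G)}\sum_{j\neq i}\alpha^{d(i,j)}$. *)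

theory Defs
  imports Complex_Main "Graph_Theory.Graph_Theory"
begin

text \<open>
  A finite simple graph is a \<^locale>\<open>graph\<close>: a finite symmetric digraph without loops and
  parallel arcs. Every undirected edge is represented by two opposite arcs, so that edges are
  counted as two-element sets of end points, and the degree of a vertex is its out-degree.
\<close>

definition edge_count :: "('a, 'b) pre_digraph \<Rightarrow> nat" where
  "edge_count G = card ((\<lambda>e. {tail G e, head G e}) ` arcs G)"

text \<open>
  In a symmetric digraph the walk \<open>u, v, u\<close> also satisfies \<^const>\<open>pre_digraph.cycle\<close>; for
  \<open>k \<ge> 3\<close> the directed cycles of length \<open>k\<close> are exactly the oriented undirected cycles.
\<close>

definition has_cycle_of_length :: "('a, 'b) pre_digraph \<Rightarrow> nat \<Rightarrow> bool" where
  "has_cycle_of_length G k \<longleftrightarrow> (\<exists>p. pre_digraph.cycle G p \<and> length p = k)"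

definition triangle_free :: "('a, 'b) pre_digraph \<Rightarrow> bool" where
  "triangle_free G \<longleftrightarrow> \<not> has_cycle_of_length G 3"

definition quadrangle_free :: "('a, 'b) pre_digraph \<Rightarrow> bool" where
  "quadrangle_free G \<longleftrightarrow> \<not> has_cycle_of_length G 4"

text \<open>Only meaningful if \<open>v\<close> is reachable from \<open>u\<close>.\<close>

definition graph_dist :: "('a, 'b) pre_digraph \<Rightarrow> 'a \<Rightarrow> 'a \<Rightarrow> nat" where
  "graph_dist G u v = (LEAST k. \<exists>p. pre_digraph.awalk G u p v \<and> length p = k)"

definition diameter :: "('a, 'b) pre_digraph \<Rightarrow> nat" where
  "diameter G = Max ((\<lambda>(u, v). graph_dist G u v) ` (verts G \<times> verts G))"

definition first_zagreb_index :: "('a, 'b) pre_digraph \<Rightarrow> nat" where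
  "first_zagreb_index G = (\<Sum>v\<in>verts G. (out_degree G v)\<^sup>2)"

definition closeness :: "('a, 'b) pre_digraph \<Rightarrow> real" where
  "closeness G = (\<Sum>i\<in>verts G. \<Sum>j\<in>verts G - {i}. 1 / 2 ^ graph_dist G i j)"

definition generalized_closeness :: "real \<Rightarrow> ('a, 'b) pre_digraph \<Rightarrow> real" where
  "generalized_closeness \<alpha> G = (\<Sum>i\<in>verts G. \<Sum>j\<in>verts G - {i}. \<alpha> ^ graph_dist G i j)"

end

theory Submission
  imports Defs
begin

text \<open>
  Split the \<open>n (n - 1)\<close> ordered pairs of distinct vertices by distance. The pairs at distance 1
  are the \<open>2 m\<close> arcs. Sending a path \<open>u, v, w\<close> with \<open>u \<noteq> w\<close> to \<open>(u, w)\<close> is injective, as there is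
  no quadrangle, and its image consists of the pairs at distance 2, as there is no triangle;
  counting the paths by their middle vertex, there are \<open>M\<^sub>1 - 2 m\<close> such pairs. Each of the remaining
  \<open>n (n - 1) - M\<^sub>1\<close> pairs has a distance between 3 and \<open>d\<close>, and there are none of them if
  \<open>d < 3\<close>.
\<close>

section \<open>Ordered pairs against edges, and walks of length one and two\<close>

text \<open>Every fibre of the map to unordered pairs has exactly two elements: symmetry supplies
  the reversed pair, and irreflexivity makes it a different one. Applied to
  \<open>arcs_ends G\<close>, this yields the factor 2 in front of
  \<open>edge_count G\<close>.\<close>

lemma card_symmetric_irreflexive:
  assumes "finite A" and "sym A" and "\<And>x. (x, x) \<notin> A"
  shows "card A = 2 * card ((\<lambda>(u, v). {u, v}) ` A)"
proof -
  let ?f = "\<lambda>(u, v). {u, v}"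
  have fibre: "card {x \<in> A. ?f x = S} = 2" if "S \<in> ?f ` A" for S
  proof -
    from that obtain u v where uv: "(u, v) \<in> A" "S = {u, v}" by auto
    with assms(2,3) have "(v, u) \<in> A" "u \<noteq> v" by (auto dest: symD)
    with uv have "{x \<in> A. ?f x = S} = {(u, v), (v, u)}"
      by (auto simp: doubleton_eq_iff)
    with \<open>u \<noteq> v\<close> show ?thesis by simp
  qed
  have "card A = (\<Sum>S\<in>?f ` A. \<Sum>x\<in>{x \<in> A. ?f x = S}. 1)"
    using sum.image_gen[OF assms(1), of "\<lambda>_. 1::nat" ?f] by simp
  also have "\<dots> = (\<Sum>S\<in>?f ` A. 2)"
    by (rule sum.cong[OF refl]) (simp add: fibre)
  finally show ?thesis by simp
qed

lemma (in wf_digraph) awalk_length_1_iff: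
  "(\<exists>p. awalk u p v \<and> length p = 1) \<longleftrightarrow> (u, v) \<in> arcs_ends G"
proof
  assume "\<exists>p. awalk u p v \<and> length p = 1"
  then show "(u, v) \<in> arcs_ends G"
    by (auto simp: length_Suc_conv awalk_simps arcs_ends_conv)
next
  assume "(u, v) \<in> arcs_ends G"
  then obtain e where "e \<in> arcs G" "tail G e = u" "head G e = v" by (rule reachableE)
  then show "\<exists>p. awalk u p v \<and> length p = 1"
    by (intro exI[of _ "[e]"]) (auto simp: awalk_simps)
qed

lemma (in wf_digraph) awalk_length_2_iff:
  "(\<exists>p. awalk u p w \<and> length p = 2) \<longleftrightarrow> (\<exists>v. (u, v) \<in> arcs_ends G \<and> (v, w) \<in> arcs_ends G)"
proof
  assume "\<exists>p. awalk u p w \<and> length p = 2"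
  then show "\<exists>v. (u, v) \<in> arcs_ends G \<and> (v, w) \<in> arcs_ends G"
    by (auto simp: numeral_2_eq_2 length_Suc_conv awalk_simps)
      (metis in_arcs_imp_in_arcs_ends)
next
  assume "\<exists>v. (u, v) \<in> arcs_ends G \<and> (v, w) \<in> arcs_ends G"
  then obtain e f where "e \<in> arcs G" "f \<in> arcs G" "tail G e = u" "head G e = tail G f"
    "head G f = w" by (auto simp: arcs_ends_conv)
  then show "\<exists>p. awalk u p w \<and> length p = 2"
    by (intro exI[of _ "[e, f]"]) (auto simp: awalk_simps)
qed

lemma graph_dist_le:
  assumes "pre_digraph.awalk G u p v"
  shows "graph_dist G u v \<le> length p"
  unfolding graph_dist_def by (rule Least_le) (use assms in blast)

section \<open>Distances 0, 1 and 2 in a connected graph\<close>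

context graph
begin

text \<open>Connectedness is defined through the symmetric closure of the arcs; in a graph the arcs
  are already symmetric, so the closure adds no reachability.\<close>

lemma connected_imp_reachable:
  assumes "Digraph_Component.connected G" "u \<in> verts G" "v \<in> verts G"
  shows "u \<rightarrow>\<^sup>* v"
  using assms by (auto simp: connected_def reachable_mk_symmetric_eq[OF sym_arcs])

text \<open>Connectedness makes the set of walk lengths nonempty, so the \<open>LEAST\<close> in
  \<open>graph_dist\<close> is attained.\<close>

lemma shortest_awalk:
  assumes "Digraph_Component.connected G" "u \<in> verts G" "v \<in> verts G"
  obtains p where "awalk u p v" "length p = graph_dist G u v"
proof -
  from connected_imp_reachable[OF assms] have "\<exists>k p. awalk u p v \<and> length p = k"
    by (simp add: reachable_awalk)
  from LeastI_ex[OF this] show ?thesis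
    by (auto simp: graph_dist_def intro: that)
qed

lemma graph_dist_eq_0_iff:
  assumes "Digraph_Component.connected G" "u \<in> verts G" "v \<in> verts G"
  shows "graph_dist G u v = 0 \<longleftrightarrow> u = v"
proof
  assume "graph_dist G u v = 0"
  with shortest_awalk[OF assms] show "u = v" by (metis awalk_Nil_iff length_0_conv)
next
  assume "u = v"
  with assms graph_dist_le[of G u "[]" v] show "graph_dist G u v = 0"
    by (simp add: awalk_Nil_iff)
qed

lemma graph_dist_eq_1_iff:
  assumes "Digraph_Component.connected G" "u \<in> verts G" "v \<in> verts G"
  shows "graph_dist G u v = 1 \<longleftrightarrow> (u, v) \<in> arcs_ends G"
proof
  assume "graph_dist G u v = 1"
  with shortest_awalk[OF assms] show "(u, v) \<in> arcs_ends G"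
    by (metis awalk_length_1_iff)
next
  assume *: "(u, v) \<in> arcs_ends G"
  then obtain p where "awalk u p v" "length p = 1" by (metis awalk_length_1_iff)
  then have "graph_dist G u v \<le> 1" using graph_dist_le by metis
  moreover have "graph_dist G u v \<noteq> 0"
    using * adj_not_same graph_dist_eq_0_iff[OF assms] by auto
  ultimately show "graph_dist G u v = 1" by simp
qed

lemma graph_dist_eq_2_iff:
  assumes "Digraph_Component.connected G" "u \<in> verts G" "w \<in> verts G"
  shows "graph_dist G u w = 2 \<longleftrightarrow>
    u \<noteq> w \<and> (u, w) \<notin> arcs_ends G \<and> (\<exists>v. (u, v) \<in> arcs_ends G \<and> (v, w) \<in> arcs_ends G)"
    (is "_ \<longleftrightarrow> ?R")
proof
  assume d: "graph_dist G u w = 2"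
  with shortest_awalk[OF assms] have "\<exists>v. (u, v) \<in> arcs_ends G \<and> (v, w) \<in> arcs_ends G"
    by (metis awalk_length_2_iff)
  with d graph_dist_eq_0_iff[OF assms] graph_dist_eq_1_iff[OF assms] show ?R by auto
next
  assume R: ?R
  then obtain p where "awalk u p w" "length p = 2" by (metis awalk_length_2_iff)
  then have "graph_dist G u w \<le> 2" using graph_dist_le by metis
  with R graph_dist_eq_0_iff[OF assms] graph_dist_eq_1_iff[OF assms]
  show "graph_dist G u w = 2" by linarith
qed

lemma graph_dist_le_diameter:
  assumes "u \<in> verts G" "v \<in> verts G"
  shows "graph_dist G u v \<le> diameter G"
  unfolding diameter_def by (rule Max_ge) (use assms in auto)

section \<open>Degrees and the number of edges\<close>

lemma card_arcs_ends: "card (arcs_ends G) = 2 * edge_count G"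
proof -
  have "card (arcs_ends G) = 2 * card ((\<lambda>(u, v). {u, v}) ` arcs_ends G)"
    by (rule card_symmetric_irreflexive)
      (use sym_arcs adj_not_same in \<open>auto simp: symmetric_def arcs_ends_def\<close>)
  then show ?thesis
    by (simp add: edge_count_def arcs_ends_conv image_image)
qed

text \<open>Without parallel arcs, an arc leaving \<open>v\<close> is determined by its
  head.\<close>

lemma out_degree_eq_card_neighbours: "out_degree G v = card {w. (v, w) \<in> arcs_ends G}"
proof -
  have "{w. (v, w) \<in> arcs_ends G} = head G ` out_arcs G v"
    by (auto simp: arcs_ends_conv)
  moreover have "inj_on (head G) (out_arcs G v)"
    by (auto intro!: inj_onI no_multi_arcs simp: arc_to_ends_def)
  ultimately show ?thesis by (simp add: out_degree_def card_image)
qed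

lemma finite_neighbours: "finite {w. (v, w) \<in> arcs_ends G}"
  by (rule finite_subset[of _ "verts G"]) (auto dest: adj_in_verts)

text \<open>The handshake lemma: the adjacent ordered pairs are grouped by their first
  component.\<close>

lemma sum_out_degree: "(\<Sum>v\<in>verts G. out_degree G v) = 2 * edge_count G"
proof -
  have "arcs_ends G = Sigma (verts G) (\<lambda>v. {w. (v, w) \<in> arcs_ends G})"
    by (auto dest: adj_in_verts)
  from arg_cong[where f = card, OF this]
  have "card (arcs_ends G) = (\<Sum>v\<in>verts G. card {w. (v, w) \<in> arcs_ends G})"
    by (simp add: finite_neighbours)
  then show ?thesis by (simp add: card_arcs_ends out_degree_eq_card_neighbours)
qed

section \<open>Excluded short cycles\<close>

lemma triangle_freeD:
  assumes "triangle_free G" "(u, v) \<in> arcs_ends G" "(v, w) \<in> arcs_ends G"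
  shows "(u, w) \<notin> arcs_ends G"
proof
  assume "(u, w) \<in> arcs_ends G"
  then have "(w, u) \<in> arcs_ends G" by (rule graph_symmetric)
  with assms obtain e f g where efg: "e \<in> arcs G" "f \<in> arcs G" "g \<in> arcs G"
    "tail G e = u" "head G e = v" "tail G f = v" "head G f = w" "tail G g = w" "head G g = u"
    by (auto simp: arcs_ends_conv)
  then have "cycle [e, f, g]"
    unfolding cycle_def using no_loops[of e] no_loops[of f] no_loops[of g]
    by (intro exI[of _ u]) (auto simp: awalk_simps)
  with assms(1) show False
    by (auto simp: triangle_free_def has_cycle_of_length_def)
qed

text \<open>Two distinct vertices have at most one common neighbour. Otherwise \<open>u\<close>,
  \<open>v\<close>, \<open>w\<close>, \<open>v'\<close> form a cycle: consecutive vertices differ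
  because there are no loops, opposite ones because \<open>u \<noteq> w\<close> and
  \<open>v \<noteq> v'\<close>.\<close>

lemma quadrangle_freeD:
  assumes "quadrangle_free G" "u \<noteq> w"
    and "(u, v) \<in> arcs_ends G" "(v, w) \<in> arcs_ends G"
    and "(u, v') \<in> arcs_ends G" "(v', w) \<in> arcs_ends G"
  shows "v = v'"
proof (rule ccontr)
  assume "v \<noteq> v'"
  have "(w, v') \<in> arcs_ends G" "(v', u) \<in> arcs_ends G"
    using assms(5,6) by (auto intro: graph_symmetric)
  with assms(3,4) obtain e f g h where efgh: "e \<in> arcs G" "f \<in> arcs G" "g \<in> arcs G" "h \<in> arcs G"
    "tail G e = u" "head G e = v" "tail G f = v" "head G f = w"
    "tail G g = w" "head G g = v'" "tail G h = v'" "head G h = u"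
    by (auto simp: arcs_ends_conv)
  then have "cycle [e, f, g, h]"
    unfolding cycle_def using \<open>v \<noteq> v'\<close> assms(2)
      no_loops[of e] no_loops[of f] no_loops[of g] no_loops[of h]
    by (intro exI[of _ u]) (auto simp: awalk_simps)
  with assms(1) show False
    by (auto simp: quadrangle_free_def has_cycle_of_length_def)
qed

section \<open>Counting the pairs at distance two\<close>

lemma card_pairs_dist_2:
  assumes "Digraph_Component.connected G" "triangle_free G" "quadrangle_free G"
  shows "card {(u, w). u \<in> verts G \<and> w \<in> verts G \<and> graph_dist G u w = 2} + 2 * edge_count G
    = first_zagreb_index G" (is "card ?P + _ = _")
proof -
  let ?N = "\<lambda>v. {w. (v, w) \<in> arcs_ends G}"
  \<comment> \<open>A path \<open>u, v, w\<close> with distinct ends is stored as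
    \<open>(v, u, w)\<close>, middle vertex first, so \<open>snd\<close> sends it to its pair of
    ends and the fibre over \<open>v\<close> consists of the ordered pairs of distinct neighbours of
    \<open>v\<close>.\<close>
  let ?W = "Sigma (verts G) (\<lambda>v. ?N v \<times> ?N v - Id_on (?N v))"
  have P: "?P = snd ` ?W"
  proof (intro equalityI subrelI)
    fix u w assume "(u, w) \<in> ?P"
    with graph_dist_eq_2_iff[OF assms(1)] obtain v where
      "u \<noteq> w" "(u, v) \<in> arcs_ends G" "(v, w) \<in> arcs_ends G" by auto
    then have "(v, u, w) \<in> ?W" by (auto intro: graph_symmetric dest: adj_in_verts)
    then show "(u, w) \<in> snd ` ?W" by force
  next
    fix u w assume "(u, w) \<in> snd ` ?W"
    then obtain v where v: "(v, u) \<in> arcs_ends G" "(v, w) \<in> arcs_ends G" "u \<noteq> w"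
      by (auto simp: Id_on_iff)
    then have uv: "(u, v) \<in> arcs_ends G" by (simp add: graph_symmetric)
    then have verts: "u \<in> verts G" "w \<in> verts G" using v adj_in_verts by blast+
    \<comment> \<open>Triangle-freeness rules out distance 1 between the ends of the path.\<close>
    moreover have "graph_dist G u w = 2"
      using uv v triangle_freeD[OF assms(2) uv v(2)] graph_dist_eq_2_iff[OF assms(1) verts]
      by blast
    ultimately show "(u, w) \<in> ?P" by simp
  qed
  \<comment> \<open>By quadrangle-freeness the two ends determine the middle vertex.\<close>
  have "inj_on snd ?W"
  proof (rule inj_onI)
    fix x y assume "x \<in> ?W" "y \<in> ?W" "snd x = snd y"
    moreover obtain v u w v' where "x = (v, u, w)" "y = (v', u, w)"
      using \<open>snd x = snd y\<close> by (metis prod.collapse)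
    ultimately show "x = y"
      using quadrangle_freeD[OF assms(3), of u w v v'] by (auto simp: Id_on_iff graph_symmetric)
  qed
  with P have "card ?P = card ?W" by (simp add: card_image)
  also have "\<dots> = (\<Sum>v\<in>verts G. card (?N v \<times> ?N v - Id_on (?N v)))"
    by (rule card_SigmaI) (auto simp: finite_neighbours)
  finally have "card ?P + (\<Sum>v\<in>verts G. out_degree G v)
    = (\<Sum>v\<in>verts G. card (?N v \<times> ?N v - Id_on (?N v)) + out_degree G v)"
    by (simp add: sum.distrib)
  also have "\<dots> = (\<Sum>v\<in>verts G. (out_degree G v)\<^sup>2)"
  proof (rule sum.cong[OF refl])
    fix v
    have Id: "Id_on (?N v) = (\<lambda>x. (x, x)) ` ?N v" by auto
    have c: "card (Id_on (?N v)) = card (?N v)"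
      unfolding Id by (rule card_image) (auto intro: inj_onI)
    \<comment> \<open>With \<open>k\<close> the degree of \<open>v\<close>, there are
      \<open>k * k - k\<close> pairs off the diagonal. Adding the degree back gives the square, and
      keeps truncated subtraction out of the final identity.\<close>
    have "card (?N v \<times> ?N v - Id_on (?N v)) = card (?N v \<times> ?N v) - card (?N v)"
      unfolding c[symmetric] by (rule card_Diff_subset) (auto simp: Id finite_neighbours)
    then show "card (?N v \<times> ?N v - Id_on (?N v)) + out_degree G v = (out_degree G v)\<^sup>2"
      by (simp add: out_degree_eq_card_neighbours card_cartesian_product power2_eq_square)
  qed
  finally show ?thesis by (simp add: sum_out_degree first_zagreb_index_def)
qed

section \<open>Splitting sums over pairs by distance\<close>

definition far_pairs :: "('a \<times> 'a) set" where
  "far_pairs = {(u, v). u \<in> verts G \<and> v \<in> verts G \<and> 3 \<le> graph_dist G u v}"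

lemma finite_far_pairs: "finite far_pairs"
  by (rule finite_subset[of _ "verts G \<times> verts G"]) (auto simp: far_pairs_def)

text \<open>The weight \<open>f\<close> is left arbitrary for two uses: a constant weight counts
  \<open>far_pairs\<close>, and powers of \<alpha> give the generalized closeness.\<close>

lemma sum_distinct_pairs_by_dist:
  fixes f :: "nat \<Rightarrow> real"
  assumes "Digraph_Component.connected G" "triangle_free G" "quadrangle_free G"
  shows "(\<Sum>u\<in>verts G. \<Sum>v\<in>verts G - {u}. f (graph_dist G u v))
    = 2 * real (edge_count G) * f 1
      + (real (first_zagreb_index G) - 2 * real (edge_count G)) * f 2
      + (\<Sum>(u, v)\<in>far_pairs. f (graph_dist G u v))"
proof -
  let ?g = "\<lambda>(u, v). f (graph_dist G u v)"
  let ?P = "{(u, w). u \<in> verts G \<and> w \<in> verts G \<and> graph_dist G u w = 2}"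
  note dist_iffs = graph_dist_eq_0_iff[OF assms(1)] graph_dist_eq_1_iff[OF assms(1)]
  have fin: "finite (arcs_ends G)" by (simp add: arcs_ends_def)
  have finP: "finite ?P" by (rule finite_subset[of _ "verts G \<times> verts G"]) auto
  have arcs_1: "graph_dist G u v = 1" if "(u, v) \<in> arcs_ends G" for u v
    using that dist_iffs(2) adj_in_verts by blast
  have "Sigma (verts G) (\<lambda>u. verts G - {u}) = arcs_ends G \<union> (?P \<union> far_pairs)"
  proof (intro equalityI subrelI)
    fix u v assume "(u, v) \<in> Sigma (verts G) (\<lambda>u. verts G - {u})"
    then have uv: "u \<in> verts G" "v \<in> verts G" "graph_dist G u v \<noteq> 0" using dist_iffs(1) by auto
    then consider "graph_dist G u v = 1" | "graph_dist G u v = 2" | "3 \<le> graph_dist G u v"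
      by linarith
    then show "(u, v) \<in> arcs_ends G \<union> (?P \<union> far_pairs)"
      using uv dist_iffs(2) by cases (auto simp: far_pairs_def)
  next
    fix u v assume "(u, v) \<in> arcs_ends G \<union> (?P \<union> far_pairs)"
    then have "u \<in> verts G" "v \<in> verts G" "graph_dist G u v \<noteq> 0"
      using arcs_1 by (auto simp: far_pairs_def dest: adj_in_verts)
    then show "(u, v) \<in> Sigma (verts G) (\<lambda>u. verts G - {u})" using dist_iffs(1) by auto
  qed
  moreover have "arcs_ends G \<inter> (?P \<union> far_pairs) = {}" "?P \<inter> far_pairs = {}"
    by (auto simp: far_pairs_def dest!: arcs_1)
  ultimately have "sum ?g (Sigma (verts G) (\<lambda>u. verts G - {u}))
      = sum ?g (arcs_ends G) + (sum ?g ?P + sum ?g far_pairs)"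
    using fin finP finite_far_pairs by (simp add: sum.union_disjoint)
  moreover have "sum ?g (arcs_ends G) = (\<Sum>_\<in>arcs_ends G. f 1)"
    by (rule sum.cong) (auto simp: arcs_1)
  moreover have "sum ?g ?P = (\<Sum>_\<in>?P. f 2)"
    by (rule sum.cong) auto
  moreover have "real (card ?P) = real (first_zagreb_index G) - 2 * real (edge_count G)"
    using card_pairs_dist_2[OF assms] by linarith
  ultimately show ?thesis
    by (simp add: sum.Sigma card_arcs_ends)
qed

lemma card_far_pairs:
  assumes "Digraph_Component.connected G" "triangle_free G" "quadrangle_free G"
  shows "real (card far_pairs)
    = real (card (verts G)) * (real (card (verts G)) - 1) - real (first_zagreb_index G)"
proof -
  have "(\<Sum>u\<in>verts G. \<Sum>v\<in>verts G - {u}. 1)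
      = real (card (verts G)) * (real (card (verts G)) - 1)"
  \<comment> \<open>The inner sum is a natural-number cardinality \<open>card (verts G) - 1\<close>;
    it becomes a real difference only if there is a vertex.\<close>
  proof (cases "verts G = {}")
    case False
    then have "1 \<le> card (verts G)" by (simp add: Suc_le_eq card_gt_0_iff)
    then show ?thesis by simp
  qed simp
  with sum_distinct_pairs_by_dist[OF assms, of "\<lambda>_. 1"] show ?thesis by simp
qed

section \<open>Bounds for the closeness\<close>

text \<open>Only the far pairs contribute inexactly. Their distances lie between 3 and the diameter,
  and powers of \<alpha> decrease in the exponent. The third claim makes both bounds coincide, which
  forces equality.\<close>

lemma generalized_closeness_bounds:
  fixes \<alpha> :: real
  assumes "Digraph_Component.connected G" "triangle_free G" "quadrangle_free G"
    and "0 < \<alpha>" "\<alpha> < 1"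
  defines "near \<equiv> \<alpha>\<^sup>2 * (real (first_zagreb_index G) - 2 * real (edge_count G))
                  + 2 * real (edge_count G) * \<alpha>"
    and "far \<equiv> real (card (verts G)) * (real (card (verts G)) - 1) - real (first_zagreb_index G)"
  shows "\<alpha> ^ diameter G * far + near \<le> generalized_closeness \<alpha> G"
    and "generalized_closeness \<alpha> G \<le> \<alpha> ^ 3 * far + near"
    and "diameter G \<le> 3 \<Longrightarrow> \<alpha> ^ diameter G * far = \<alpha> ^ 3 * far"
proof -
  have GC: "generalized_closeness \<alpha> G
      = near + (\<Sum>(u, v)\<in>far_pairs. \<alpha> ^ graph_dist G u v)"
    using sum_distinct_pairs_by_dist[OF assms(1-3), of "\<lambda>k. \<alpha> ^ k"]
    by (simp add: generalized_closeness_def near_def)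
  have far: "far = real (card far_pairs)"
    using card_far_pairs[OF assms(1-3)] by (simp add: far_def)
  have "(\<Sum>_\<in>far_pairs. \<alpha> ^ diameter G) \<le> (\<Sum>(u, v)\<in>far_pairs. \<alpha> ^ graph_dist G u v)"
    using assms(4,5)
    by (intro sum_mono) (auto simp: far_pairs_def intro!: power_decreasing graph_dist_le_diameter)
  then show "\<alpha> ^ diameter G * far + near \<le> generalized_closeness \<alpha> G"
    by (simp add: GC far mult.commute)
  have "(\<Sum>(u, v)\<in>far_pairs. \<alpha> ^ graph_dist G u v) \<le> (\<Sum>_\<in>far_pairs. \<alpha> ^ 3)"
    using assms(4,5) by (intro sum_mono) (auto simp: far_pairs_def intro!: power_decreasing)
  then show "generalized_closeness \<alpha> G \<le> \<alpha> ^ 3 * far + near"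
    by (simp add: GC far mult.commute)
  assume "diameter G \<le> 3"
  show "\<alpha> ^ diameter G * far = \<alpha> ^ 3 * far"
  proof (cases "diameter G = 3")
    \<comment> \<open>Below diameter 3 the two powers of \<alpha> differ, but there are no far
      pairs, so \<open>far\<close> is 0.\<close>
    case False
    with \<open>diameter G \<le> 3\<close> have "far_pairs = {}"
      using graph_dist_le_diameter by (fastforce simp: far_pairs_def)
    then show ?thesis by (simp add: far)
  qed simp
qed

end

lemma closeness_eq_generalized_closeness: "closeness G = generalized_closeness (1 / 2) G"
  by (simp add: closeness_def generalized_closeness_def power_one_over)

theorem theorem3p3:
  fixes G :: "('a, 'b) pre_digraph"
    and n m d M\<^sub>1 :: nat
    and \<alpha> L U :: real
  assumes "graph G"
    and "Digraph_Component.connected G"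
    and "triangle_free G"
    and "quadrangle_free G"
    and "n = card (verts G)"
    and "m = edge_count G"
    and "d = diameter G"
    and "M\<^sub>1 = first_zagreb_index G"
    and "0 < \<alpha>" and "\<alpha> < 1"
    and "L = \<alpha> ^ d * (real n * (real n - 1) - real M\<^sub>1)
             + \<alpha>\<^sup>2 * (real M\<^sub>1 - 2 * real m) + 2 * real m * \<alpha>"
    and "U = \<alpha> ^ 3 * (real n * (real n - 1) - real M\<^sub>1)
             + \<alpha>\<^sup>2 * (real M\<^sub>1 - 2 * real m) + 2 * real m * \<alpha>"
  shows "L \<le> generalized_closeness \<alpha> G \<and> generalized_closeness \<alpha> G \<le> U
    \<and> (real n * (real n - 1) - real M\<^sub>1) / 2 ^ d + (real M\<^sub>1 + 2 * real m) / 4 \<le> closeness G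
    \<and> closeness G \<le> (real n * (real n - 1) + real M\<^sub>1 + 4 * real m) / 8
    \<and> (d \<le> 3 \<longrightarrow>
         generalized_closeness \<alpha> G = L \<and> generalized_closeness \<alpha> G = U
         \<and> closeness G = (real n * (real n - 1) - real M\<^sub>1) / 2 ^ d + (real M\<^sub>1 + 2 * real m) / 4
         \<and> closeness G = (real n * (real n - 1) + real M\<^sub>1 + 4 * real m) / 8)"
proof -
  interpret graph G by fact
  note bounds = generalized_closeness_bounds[OF assms(2-4), folded assms(5-8)]
  \<comment> \<open>At \<alpha> = 1/2 the terms of the pairs at distance 1 and 2 add up to
    \<open>(M\<^sub>1 - 2m)/4 + m = (M\<^sub>1 + 2m)/4\<close>.\<close>
  have lower: "(1 / 2) ^ d * (real n * (real n - 1) - real M\<^sub>1)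
      + ((1 / 2)\<^sup>2 * (real M\<^sub>1 - 2 * real m) + 2 * real m * (1 / 2))
    = (real n * (real n - 1) - real M\<^sub>1) / 2 ^ d + (real M\<^sub>1 + 2 * real m) / 4"
    by (simp add: field_simps)
  have upper: "(1 / 2) ^ 3 * (real n * (real n - 1) - real M\<^sub>1)
      + ((1 / 2)\<^sup>2 * (real M\<^sub>1 - 2 * real m) + 2 * real m * (1 / 2))
    = (real n * (real n - 1) + real M\<^sub>1 + 4 * real m) / 8"
    by (simp add: field_simps)
  have half: "0 < (1 / 2 :: real)" "(1 / 2 :: real) < 1" by simp_all
  have L: "L \<le> generalized_closeness \<alpha> G" and U: "generalized_closeness \<alpha> G \<le> U"
    and LU: "d \<le> 3 \<Longrightarrow> L = U"
    using bounds[OF assms(9,10)] by (simp_all add: assms(11,12))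
  note C = bounds[OF half, unfolded lower upper, folded closeness_eq_generalized_closeness]
  have "d \<le> 3 \<Longrightarrow> (real n * (real n - 1) - real M\<^sub>1) / 2 ^ d + (real M\<^sub>1 + 2 * real m) / 4
      = (real n * (real n - 1) + real M\<^sub>1 + 4 * real m) / 8"
    using C(3) lower upper by linarith
  \<comment> \<open>For \<open>d \<le> 3\<close> each closeness is squeezed between two equal
    bounds.\<close>
  with L U LU C(1,2) show ?thesis by (intro conjI impI) linarith+
qed

end
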